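(* Let $T=\langle Tree,\unlhd\rangle$ be a temporal frame for $Ag$. For every constant specification $\mathcal{CS}$, the following are equivalent: (i) for every $\mathcal{CS}$-normal jstit model $\mathcal{M}$ for $Ag$ based on $T$, every formula $A\in Form^{Ag}$ with $\vdash_{\mathcal{CS}}A$ satisfies $\mathcal{M}\models A$; (ii) $T$ is a mixed successor frame, i.e. $T\in\mathcal{T}^{Ag}_{mixsucc}$.
   Context: Language. $Ag$ is a fixed finite set (agents). $PVar$ (proof variables $x,y,z,\dots$), $PConst$ (proof constants $c,d,\dots$) and $Var$ (propositional variables $p,q,\dots$) are countably infinite; all these sets are pairwise disjoint. Proof polynomials $Pol$: $t:=x\mid c\mid s+t\mid s\times t\mid\, !t$. Formulas $Form^{Ag}$: $A:=p\mid A\wedge B\mid\neg A\mid[j]A\mid\Box A\mid t{:}A\mid KA\mid Et$ with $p\in Var$, $j\in Ag$, $t\in Pol$. Other Boolean connectives are the usual abbreviations; $\Diamond=\neg\Box\neg$. Frames. Let $Tree\neq\emptyset$ (moments) and let $\unlhd$ be a partial order on $Tree$ with irreflexive part $\lhd$. $Hist$ is the set of maximal $\unlhd$-chains (histories); $H_m=\{h\in Hist\mid m\in h\}$; $MH=\{(m,h)\mid m\in Tree,h\in H_m\}$. For $h,g\in H_m$, $h\approx_m g$ iff there is $m'\rhd m$ with $h,g\in H_{m'}$. $Next(m,m')$ means $m\lhd m'$ and $(\forall m''\lhd m')(m''\unlhd m)$. $\langle Tree,\unlhd\rangle$ is a temporal frame if: (1) $\forall m,m_1\exists m_2(m_2\unlhd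 m\wedge m_2\unlhd m_1)$; (2) $\forall m,m_1,m_2((m_1\unlhd m\wedge m_2\unlhd m)\Rightarrow(m_1\unlhd m_2\vee m_2\unlhd m_1))$. $\langle Tree,\unlhd,Choice\rangle$ is a stit frame for $Ag$ if moreover $Choice$ assigns to each $m\in Tree$, $j\in Ag$ a partition $Choice^m_j$ of $H_m$ ($Choice^m_j(h)$ is the cell containing $h$) such that (3) $h\approx_m h'$ implies $Choice^m_j(h)=Choice^m_j(h')$; (4) for every $m$ and every function $f$ on $Ag$ with $f(j)\in Choice^m_j$ for all $j$, $\bigcap_{j\in Ag}f(j)\neq\emptyset$. $\langle Tree,\unlhd,Choice,R,R_e\rangle$ is a jstit frame for $Ag$ if moreover $R,R_e$ are pre-orders on $Tree$ with $\unlhd\subseteq R\subseteq R_e$. (Equivalently, these frames are the corresponding reducts of the jstit models defined next.) Models. A jstit model for $Ag$ is $\mathcal{M}=\langle Tree,\unlhd,Choice,Act,R,R_e,\mathcal{E},V\rangle$ where $\langle Tree,\unlhd,Choice,R,R_e\rangle$ is a jstit frame for $Ag$, $Act:MH\to2^{Pol}$, $\mathcal{E}:Tree\times Pol\to2^{Form^{Ag}}$, $V:Var\to2^{MH}$, and, writing $Act_m=\bigcap_{h\in H_m}Act(m,h)$: - $R_e(m,m')\Rightarrow\mathcal{E}(m,t)\subseteq\mathcal{E}(m',t)$; - if $A\to B\in\mathcal{E}(m,s)$ and $A\in\mathcal{E}(m,t)$ then $B\in\mathcal{E}(m,s\times t)$; $\mathcal{E}(m,s)\cup\mathcal{E}(m,t)\subseteq\mathcal{E}(m,s+t)$;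 $A\in\mathcal{E}(m,t)\Rightarrow t{:}A\in\mathcal{E}(m,!t)$; - $m'\lhd m\Rightarrow\forall h\in H_m\,(Act(m',h)\subseteq Act(m,h))$; - $Act_m\subseteq\bigcup_{m'\lhd m,\,h\in H_m}Act(m',h)$; - for $h,h'\in H_m$: $h\approx_m h'\Rightarrow Act(m,h)=Act(m,h')$; - $R_e(m,m')\Rightarrow Act_m\subseteq Act_{m'}$. A model is based on each of its frame reducts (jstit, stit, temporal). Satisfaction at $(m,h)\in MH$: $p$ iff $(m,h)\in V(p)$; standard Boolean clauses; $[j]A$ iff $\mathcal{M},m,h'\models A$ for all $h'\in Choice^m_j(h)$; $\Box A$ iff $\mathcal{M},m,h'\models A$ for all $h'\in H_m$; $KA$ iff $\mathcal{M},m',h'\models A$ whenever $R(m,m')$ and $h'\in H_{m'}$; $t{:}A$ iff $A\in\mathcal{E}(m,t)$ and $\mathcal{M},m',h'\models A$ whenever $R_e(m,m')$ and $h'\in H_{m'}$; $Et$ iff $t\in Act(m,h)$. $\mathcal{M}\models A$ means $\mathcal{M},m,h\models A$ for all $(m,h)\in MH$. Axiom schemes: (A0) classical propositional axioms; (A1) S5 axioms for $\Box$ and each $[j]$; (A2) $\Box A\to[j]A$; (A3) $(\Diamond[j_1]A_1\wedge\dots\wedge\Diamond[j_n]A_n)\to\Diamond([j_1]A_1\wedge\dots\wedge[j_n]A_n)$ for pairwise different $j_1,\dots,j_n$; (A4) $s{:}(A\to B)\to(t{:}A\to(s\times t){:}B)$; (A5) $t{:}A\to(!t{:}(t{:}A)\wedge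 KA)$; (A6) $(s{:}A\vee t{:}A)\to(s+t){:}A$; (A7) S4 axioms for $K$; (A8) $KA\to\Box K\Box A$; (A9) $\Box Et\to K\Box Et$. A constant specification is a set $\mathcal{CS}\subseteq\{c_n{:}\dots c_1{:}A\mid c_1,\dots,c_n\in PConst,\ A\text{ an instance of (A0)--(A9)}\}$ such that $c_{n+1}{:}c_n{:}\dots c_1{:}A\in\mathcal{CS}$ implies $c_n{:}\dots c_1{:}A\in\mathcal{CS}$. A jstit model is $\mathcal{CS}$-normal iff $\{A\mid c{:}A\in\mathcal{CS}\}\subseteq\mathcal{E}(m,c)$ for all $c\in PConst$, $m\in Tree$. System $\Sigma_D(\mathcal{CS})$: axioms (A0)--(A9) and rules (R1) from $A$, $A\to B$ infer $B$; (R2) from $A$ infer $KA$; ($R_D$) from $KA\to(\neg\Box Et_1\vee\dots\vee\neg\Box Et_n\vee\Box Es_1\vee\dots\vee\Box Es_k)$ infer $KA\to(\neg Et_1\vee\dots\vee\neg Et_n\vee Es_1\vee\dots\vee Es_k)$, where $n,k\geq0$; ($R_{\mathcal{CS}}$) infer any member of $\mathcal{CS}$. $\vdash_{\mathcal{CS}}A$ means $A$ is provable in $\Sigma_D(\mathcal{CS})$ (there is a finite sequence ending in $A$, each member of which is an axiom or obtained by a rule from earlier members). Mixed successor. A (stit or temporal) frame is a mixed successor frame iff for all $m,m_1\in Tree$: $[m\lhd m_1\Rightarrow(\exists m_2\unlhd m_1)Next(m,m_2)]\vee[(\forall h,g\in H_m)(h\approx_m g)]$. $\mathcal{T}^{Ag}_{mixsucc}$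 is the class of mixed successor temporal frames for $Ag$. *)

theory Defs
  imports Main "HOL-Library.Disjoint_Sets"
begin

text \<open>The variables and constants of each sort are indexed by natural numbers.
  The set of agents is a parameter \<open>Ag\<close>, a set of elements of an arbitrary type.\<close>

datatype pol =
    PVar nat
  | PConst nat
  | PSum pol pol  (infixl "\<oplus>" 65)
  | PApp pol pol  (infixl "\<otimes>" 70)
  | PCheck pol    ("\<^bold>! _" [80] 80)

datatype (agents: 'ag) fm =
    Prop nat
  | And "'ag fm" "'ag fm"  (infixr "\<^bold>\<and>" 60)
  | Neg "'ag fm"           ("\<^bold>\<not> _" [70] 70)
  | Stit 'ag "'ag fm"
  | Box "'ag fm"           ("\<box> _" [70] 70)
  | Prf pol "'ag fm"       (infixr "\<^bold>:" 75)
  | Know "'ag fm"          ("\<^bold>K _" [70] 70)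
  | Proven pol             ("\<^bold>E _" [80] 80)

definition Form :: "'ag set \<Rightarrow> 'ag fm set" where
  "Form Ag = {A. agents A \<subseteq> Ag}"

abbreviation Or :: "'ag fm \<Rightarrow> 'ag fm \<Rightarrow> 'ag fm"  (infixr "\<^bold>\<or>" 55) where
  "A \<^bold>\<or> B \<equiv> \<^bold>\<not> (\<^bold>\<not> A \<^bold>\<and> \<^bold>\<not> B)"

abbreviation Imp :: "'ag fm \<Rightarrow> 'ag fm \<Rightarrow> 'ag fm"  (infixr "\<^bold>\<longrightarrow>" 50) where
  "A \<^bold>\<longrightarrow> B \<equiv> \<^bold>\<not> (A \<^bold>\<and> \<^bold>\<not> B)"

abbreviation Fls :: "'ag fm"  ("\<^bold>\<bottom>") where
  "\<^bold>\<bottom> \<equiv> Prop 0 \<^bold>\<and> \<^bold>\<not> Prop 0"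

abbreviation Dia :: "'ag fm \<Rightarrow> 'ag fm"  ("\<diamond> _" [70] 70) where
  "\<diamond> A \<equiv> \<^bold>\<not> \<box> \<^bold>\<not> A"

text \<open>Only nonempty conjunctions are ever used; the empty disjunction is \<open>\<^bold>\<bottom>\<close>.\<close>

fun Conj :: "'ag fm list \<Rightarrow> 'ag fm" where
  "Conj [] = \<^bold>\<not> \<^bold>\<bottom>"
| "Conj [A] = A"
| "Conj (A # B # As) = A \<^bold>\<and> Conj (B # As)"

fun Disj :: "'ag fm list \<Rightarrow> 'ag fm" where
  "Disj [] = \<^bold>\<bottom>"
| "Disj [A] = A"
| "Disj (A # B # As) = A \<^bold>\<or> Disj (B # As)"

text \<open>The set of moments is the whole type \<open>'m\<close>, which is nonempty.
  Values of \<open>act\<close> at pairs outside \<open>MH\<close> and of \<open>choice\<close> at agents outside \<open>Ag\<close>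
  play no role.\<close>

record 'm temporal_frame =
  le :: "'m \<Rightarrow> 'm \<Rightarrow> bool"  (infix "\<unlhd>\<index>" 50)

record ('m, 'ag) stit_frame = "'m temporal_frame" +
  choice :: "'m \<Rightarrow> 'ag \<Rightarrow> 'm set set set"

record ('m, 'ag) jstit_frame = "('m, 'ag) stit_frame" +
  R  :: "'m \<Rightarrow> 'm \<Rightarrow> bool"
  Re :: "'m \<Rightarrow> 'm \<Rightarrow> bool"

record ('m, 'ag) jstit_model = "('m, 'ag) jstit_frame" +
  act :: "'m \<Rightarrow> 'm set \<Rightarrow> pol set"
  evid :: "'m \<Rightarrow> pol \<Rightarrow> 'ag fm set"
  val :: "nat \<Rightarrow> ('m \<times> 'm set) set"

definition lt :: "('m, 'z) temporal_frame_scheme \<Rightarrow> 'm \<Rightarrow> 'm \<Rightarrow> bool"  ("(_ \<lhd>\<index> _)" [51, 51] 50)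
  where "m \<lhd>\<^bsub>T\<^esub> m' \<longleftrightarrow> m \<unlhd>\<^bsub>T\<^esub> m' \<and> m \<noteq> m'"

definition Hist :: "('m, 'z) temporal_frame_scheme \<Rightarrow> 'm set set" where
  "Hist T = {h. pred_on.maxchain UNIV (le T) h}"

definition H :: "('m, 'z) temporal_frame_scheme \<Rightarrow> 'm \<Rightarrow> 'm set set" where
  "H T m = {h \<in> Hist T. m \<in> h}"

definition MH :: "('m, 'z) temporal_frame_scheme \<Rightarrow> ('m \<times> 'm set) set" where
  "MH T = {(m, h). h \<in> H T m}"

definition undivided :: "('m, 'z) temporal_frame_scheme \<Rightarrow> 'm \<Rightarrow> 'm set \<Rightarrow> 'm set \<Rightarrow> bool" where
  "undivided T m h g \<longleftrightarrow>
     h \<in> H T m \<and> g \<in> H T m \<and> (\<exists>m'. m \<lhd>\<^bsub>T\<^esub> m' \<and> h \<in> H T m' \<and> g \<in> H T m')"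

definition Next :: "('m, 'z) temporal_frame_scheme \<Rightarrow> 'm \<Rightarrow> 'm \<Rightarrow> bool" where
  "Next T m m' \<longleftrightarrow> m \<lhd>\<^bsub>T\<^esub> m' \<and> (\<forall>m''. m'' \<lhd>\<^bsub>T\<^esub> m' \<longrightarrow> m'' \<unlhd>\<^bsub>T\<^esub> m)"

definition is_temporal_frame :: "('m, 'z) temporal_frame_scheme \<Rightarrow> bool" where
  "is_temporal_frame T \<longleftrightarrow>
     reflp (le T) \<and> transp (le T) \<and> antisymp (le T) \<and>
     (\<forall>m m1. \<exists>m2. m2 \<unlhd>\<^bsub>T\<^esub> m \<and> m2 \<unlhd>\<^bsub>T\<^esub> m1) \<and>
     (\<forall>m m1 m2. m1 \<unlhd>\<^bsub>T\<^esub> m \<and> m2 \<unlhd>\<^bsub>T\<^esub> m \<longrightarrow> m1 \<unlhd>\<^bsub>T\<^esub> m2 \<or> m2 \<unlhd>\<^bsub>T\<^esub> m1)"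

definition cell :: "('m, 'ag, 'z) stit_frame_scheme \<Rightarrow> 'm \<Rightarrow> 'ag \<Rightarrow> 'm set \<Rightarrow> 'm set set" where
  "cell F m j h = (THE c. c \<in> choice F m j \<and> h \<in> c)"

definition is_stit_frame :: "'ag set \<Rightarrow> ('m, 'ag, 'z) stit_frame_scheme \<Rightarrow> bool" where
  "is_stit_frame Ag F \<longleftrightarrow>
     is_temporal_frame F \<and>
     (\<forall>m. \<forall>j\<in>Ag. partition_on (H F m) (choice F m j)) \<and>
     (\<forall>m. \<forall>j\<in>Ag. \<forall>h\<in>H F m. \<forall>h'\<in>H F m.
        undivided F m h h' \<longrightarrow> cell F m j h = cell F m j h') \<and>
     (\<forall>m f. (\<forall>j\<in>Ag. f j \<in> choice F m j) \<longrightarrow> (\<Inter>j\<in>Ag. f j) \<noteq> {})"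

definition is_jstit_frame :: "'ag set \<Rightarrow> ('m, 'ag, 'z) jstit_frame_scheme \<Rightarrow> bool" where
  "is_jstit_frame Ag F \<longleftrightarrow>
     is_stit_frame Ag F \<and>
     reflp (R F) \<and> transp (R F) \<and> reflp (Re F) \<and> transp (Re F) \<and>
     le F \<le> R F \<and> R F \<le> Re F"

definition mixed_successor :: "('m, 'z) temporal_frame_scheme \<Rightarrow> bool" where
  "mixed_successor T \<longleftrightarrow>
     (\<forall>m m1. (m \<lhd>\<^bsub>T\<^esub> m1 \<longrightarrow> (\<exists>m2. m2 \<unlhd>\<^bsub>T\<^esub> m1 \<and> Next T m m2)) \<or>
             (\<forall>h\<in>H T m. \<forall>g\<in>H T m. undivided T m h g))"

definition mixsucc_temporal_frames :: "'m temporal_frame set" where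
  "mixsucc_temporal_frames = {T. is_temporal_frame T \<and> mixed_successor T}"

definition act_all :: "('m, 'ag, 'z) jstit_model_scheme \<Rightarrow> 'm \<Rightarrow> pol set" where
  "act_all M m = (\<Inter>h\<in>H M m. act M m h)"

definition is_jstit_model :: "'ag set \<Rightarrow> ('m, 'ag) jstit_model \<Rightarrow> bool" where
  "is_jstit_model Ag M \<longleftrightarrow>
     is_jstit_frame Ag M \<and>
     (\<forall>m t. evid M m t \<subseteq> Form Ag) \<and>
     (\<forall>p. val M p \<subseteq> MH M) \<and>
     (\<forall>m m' t. Re M m m' \<longrightarrow> evid M m t \<subseteq> evid M m' t) \<and>
     (\<forall>m s t A B. (A \<^bold>\<longrightarrow> B) \<in> evid M m s \<and> A \<in> evid M m t \<longrightarrow> B \<in> evid M m (s \<otimes> t)) \<and>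
     (\<forall>m s t. evid M m s \<union> evid M m t \<subseteq> evid M m (s \<oplus> t)) \<and>
     (\<forall>m t A. A \<in> evid M m t \<longrightarrow> (t \<^bold>: A) \<in> evid M m (\<^bold>! t)) \<and>
     (\<forall>m m'. m' \<lhd>\<^bsub>M\<^esub> m \<longrightarrow> (\<forall>h\<in>H M m. act M m' h \<subseteq> act M m h)) \<and>
     (\<forall>m. act_all M m \<subseteq> (\<Union>m'\<in>{m'. m' \<lhd>\<^bsub>M\<^esub> m}. \<Union>h\<in>H M m. act M m' h)) \<and>
     (\<forall>m. \<forall>h\<in>H M m. \<forall>h'\<in>H M m. undivided M m h h' \<longrightarrow> act M m h = act M m h') \<and>
     (\<forall>m m'. Re M m m' \<longrightarrow> act_all M m \<subseteq> act_all M m')"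

definition based_on :: "('m, 'ag) jstit_model \<Rightarrow> 'm temporal_frame \<Rightarrow> bool" where
  "based_on M T \<longleftrightarrow> temporal_frame.truncate M = T"

primrec sat :: "('m, 'ag) jstit_model \<Rightarrow> 'm \<Rightarrow> 'm set \<Rightarrow> 'ag fm \<Rightarrow> bool" where
  "sat M m h (Prop p) \<longleftrightarrow> (m, h) \<in> val M p"
| "sat M m h (A \<^bold>\<and> B) \<longleftrightarrow> sat M m h A \<and> sat M m h B"
| "sat M m h (\<^bold>\<not> A) \<longleftrightarrow> \<not> sat M m h A"
| "sat M m h (Stit j A) \<longleftrightarrow> (\<forall>h'\<in>cell M m j h. sat M m h' A)"
| "sat M m h (\<box> A) \<longleftrightarrow> (\<forall>h'\<in>H M m. sat M m h' A)"
| "sat M m h (t \<^bold>: A) \<longleftrightarrow>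
     A \<in> evid M m t \<and> (\<forall>m'. Re M m m' \<longrightarrow> (\<forall>h'\<in>H M m'. sat M m' h' A))"
| "sat M m h (\<^bold>K A) \<longleftrightarrow> (\<forall>m'. R M m m' \<longrightarrow> (\<forall>h'\<in>H M m'. sat M m' h' A))"
| "sat M m h (\<^bold>E t) \<longleftrightarrow> t \<in> act M m h"

definition valid_in :: "('m, 'ag) jstit_model \<Rightarrow> 'ag fm \<Rightarrow> bool" where
  "valid_in M A \<longleftrightarrow> (\<forall>(m, h)\<in>MH M. sat M m h A)"

text \<open>Propositional axioms are all substitution instances of classical tautologies: formulas
  true under every valuation of the formulas whose main connective is not Boolean.\<close>

fun bool_eval :: "('ag fm \<Rightarrow> bool) \<Rightarrow> 'ag fm \<Rightarrow> bool" where
  "bool_eval v (A \<^bold>\<and> B) \<longleftrightarrow> bool_eval v A \<and> bool_eval v B"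
| "bool_eval v (\<^bold>\<not> A) \<longleftrightarrow> \<not> bool_eval v A"
| "bool_eval v A \<longleftrightarrow> v A"

definition tautology :: "'ag fm \<Rightarrow> bool" where
  "tautology A \<longleftrightarrow> (\<forall>v. bool_eval v A)"

inductive S4_axiom :: "('ag fm \<Rightarrow> 'ag fm) \<Rightarrow> 'ag fm \<Rightarrow> bool" for N where
  S4_K: "S4_axiom N (N (A \<^bold>\<longrightarrow> B) \<^bold>\<longrightarrow> (N A \<^bold>\<longrightarrow> N B))"
| S4_T: "S4_axiom N (N A \<^bold>\<longrightarrow> A)"
| S4_4: "S4_axiom N (N A \<^bold>\<longrightarrow> N (N A))"

inductive S5_axiom :: "('ag fm \<Rightarrow> 'ag fm) \<Rightarrow> 'ag fm \<Rightarrow> bool" for N where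
  S5_S4: "S4_axiom N A \<Longrightarrow> S5_axiom N A"
| S5_5: "S5_axiom N (\<^bold>\<not> N A \<^bold>\<longrightarrow> N (\<^bold>\<not> N A))"

inductive axiom_instance :: "'ag fm \<Rightarrow> bool" where
  A0: "tautology A \<Longrightarrow> axiom_instance A"
| A1_box: "S5_axiom Box A \<Longrightarrow> axiom_instance A"
| A1_stit: "S5_axiom (Stit j) A \<Longrightarrow> axiom_instance A"
| A2: "axiom_instance (\<box> A \<^bold>\<longrightarrow> Stit j A)"
| A3: "jAs \<noteq> [] \<Longrightarrow> distinct (map fst jAs) \<Longrightarrow>
     axiom_instance (Conj (map (\<lambda>(j, A). \<diamond> Stit j A) jAs) \<^bold>\<longrightarrow>
                     \<diamond> Conj (map (\<lambda>(j, A). Stit j A) jAs))"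
| A4: "axiom_instance (s \<^bold>: (A \<^bold>\<longrightarrow> B) \<^bold>\<longrightarrow> (t \<^bold>: A \<^bold>\<longrightarrow> (s \<otimes> t) \<^bold>: B))"
| A5: "axiom_instance (t \<^bold>: A \<^bold>\<longrightarrow> ((\<^bold>! t) \<^bold>: (t \<^bold>: A) \<^bold>\<and> \<^bold>K A))"
| A6: "axiom_instance ((s \<^bold>: A \<^bold>\<or> t \<^bold>: A) \<^bold>\<longrightarrow> (s \<oplus> t) \<^bold>: A)"
| A7: "S4_axiom Know A \<Longrightarrow> axiom_instance A"
| A8: "axiom_instance (\<^bold>K A \<^bold>\<longrightarrow> \<box> \<^bold>K \<box> A)"
| A9: "axiom_instance (\<box> \<^bold>E t \<^bold>\<longrightarrow> \<^bold>K \<box> \<^bold>E t)"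

definition Axioms :: "'ag set \<Rightarrow> 'ag fm set" where
  "Axioms Ag = {A \<in> Form Ag. axiom_instance A}"

text \<open>\<open>const_prf [c\<^sub>n, \<dots>, c\<^sub>1] A\<close> is the formula \<open>c\<^sub>n : \<dots> : c\<^sub>1 : A\<close>.\<close>

definition const_prf :: "nat list \<Rightarrow> 'ag fm \<Rightarrow> 'ag fm" where
  "const_prf cs A = foldr (\<lambda>c B. PConst c \<^bold>: B) cs A"

definition constant_specification :: "'ag set \<Rightarrow> 'ag fm set \<Rightarrow> bool" where
  "constant_specification Ag CS \<longleftrightarrow>
     CS \<subseteq> {const_prf cs A |cs A. cs \<noteq> [] \<and> A \<in> Axioms Ag} \<and>
     (\<forall>c cs A. cs \<noteq> [] \<and> A \<in> Axioms Ag \<and> const_prf (c # cs) A \<in> CS \<longrightarrow> const_prf cs A \<in> CS)"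

definition CS_normal :: "'ag fm set \<Rightarrow> ('m, 'ag) jstit_model \<Rightarrow> bool" where
  "CS_normal CS M \<longleftrightarrow> (\<forall>c m. {A. (PConst c \<^bold>: A) \<in> CS} \<subseteq> evid M m (PConst c))"

inductive provable :: "'ag set \<Rightarrow> 'ag fm set \<Rightarrow> 'ag fm \<Rightarrow> bool" for Ag CS where
  Ax: "A \<in> Axioms Ag \<Longrightarrow> provable Ag CS A"
| R1: "provable Ag CS A \<Longrightarrow> provable Ag CS (A \<^bold>\<longrightarrow> B) \<Longrightarrow> provable Ag CS B"
| R2: "provable Ag CS A \<Longrightarrow> provable Ag CS (\<^bold>K A)"
| RD: "provable Ag CS
         (\<^bold>K A \<^bold>\<longrightarrow> Disj (map (\<lambda>t. \<^bold>\<not> \<box> \<^bold>E t) ts @ map (\<lambda>s. \<box> \<^bold>E s) ss)) \<Longrightarrow>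
       provable Ag CS
         (\<^bold>K A \<^bold>\<longrightarrow> Disj (map (\<lambda>t. \<^bold>\<not> \<^bold>E t) ts @ map (\<lambda>s. \<^bold>E s) ss))"
| RCS: "A \<in> CS \<Longrightarrow> provable Ag CS A"

end

theory Submission
  imports Defs
begin

text \<open>
  The rule (R_D) is the only ingredient of the calculus whose soundness depends on the temporal
  frame; the axioms, the other rules and the members of \<open>CS\<close> are sound on every normal jstit model.

  The rule (R_D) says that a configuration of proofs which, under \<open>K A\<close>, cannot be the one presented
  \<^emph>\<open>in every history\<close> through a moment cannot be presented in a single history either. Suppose
  its conclusion fails at \<open>(m, h)\<close>. If all histories through \<open>m\<close> are undivided at \<open>m\<close>, or \<open>m\<close> is the
  end of its only history, then all histories through \<open>m\<close> carry the same proofs, so \<open>E t\<close> and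
  \<open>\<box> E t\<close> agree at \<open>m\<close>. Otherwise a mixed successor frame supplies an immediate successor \<open>m\<^sub>2\<close> of
  \<open>m\<close> on \<open>h\<close>. The histories through \<open>m\<^sub>2\<close> are undivided at \<open>m\<close>, so whatever is presented at
  \<open>(m, h)\<close> is presented in all histories through \<open>m\<^sub>2\<close>; conversely, a proof presented in all
  histories through \<open>m\<^sub>2\<close> is presented in one of them already strictly before \<open>m\<^sub>2\<close>, that is, not
  after \<open>m\<close>. So \<open>\<box> E t\<close> at \<open>m\<^sub>2\<close> is equivalent to \<open>E t\<close> at \<open>(m, h)\<close>, and the
  premise fails at \<open>m\<^sub>2\<close> (lemmas \<open>act_in_history_realized\<close> and \<open>RD_sound\<close>).

  If the frame is not mixed successor, then at some \<open>m\<close> the histories split, while some \<open>h\<close> through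
  \<open>m\<close> leaves \<open>m\<close> without a first step: below every moment of \<open>h\<close> after \<open>m\<close> there is another
  moment after \<open>m\<close>. Present \<open>x\<close> at \<open>m\<close> in the histories undivided from \<open>h\<close>, and present both \<open>x\<close>
  and \<open>y\<close> at all later moments of these histories. This is admissible because \<open>y\<close> has no first
  moment of appearance (\<open>branch_no_first\<close>). Here \<open>\<box> E x \<longrightarrow> \<box> E y\<close> holds everywhere:
  both boxes hold at the later moments of these histories, and elsewhere \<open>\<box> E x\<close> fails, at \<open>m\<close>
  because the histories split there. But \<open>E x \<longrightarrow> E y\<close> fails at \<open>(m, h)\<close>, which refutes
  an instance of the conclusion of (R_D) with a provable premise (\<open>branch_model_refutes\<close>).
\<close>

section \<open>Histories of a temporal frame\<close>

lemma temporal_frameD: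
  assumes "is_temporal_frame T"
  shows "x \<unlhd>\<^bsub>T\<^esub> x"
    and "x \<unlhd>\<^bsub>T\<^esub> y \<Longrightarrow> y \<unlhd>\<^bsub>T\<^esub> z \<Longrightarrow> x \<unlhd>\<^bsub>T\<^esub> z"
    and "x \<unlhd>\<^bsub>T\<^esub> y \<Longrightarrow> y \<unlhd>\<^bsub>T\<^esub> x \<Longrightarrow> x = y"
    and "x \<unlhd>\<^bsub>T\<^esub> z \<Longrightarrow> y \<unlhd>\<^bsub>T\<^esub> z \<Longrightarrow> x \<unlhd>\<^bsub>T\<^esub> y \<or> y \<unlhd>\<^bsub>T\<^esub> x"
  using assms unfolding is_temporal_frame_def
  by (blast dest: reflpD transpD antisympD)+

text \<open>A chain is maximal iff it cannot be enlarged by a single moment, so only comparabilities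
  are needed to recognize the members of a history.\<close>

lemma Hist_iff:
  assumes "is_temporal_frame T"
  shows "h \<in> Hist T \<longleftrightarrow>
    (\<forall>x\<in>h. \<forall>y\<in>h. x \<unlhd>\<^bsub>T\<^esub> y \<or> y \<unlhd>\<^bsub>T\<^esub> x) \<and>
    (\<forall>x. (\<forall>y\<in>h. x \<unlhd>\<^bsub>T\<^esub> y \<or> y \<unlhd>\<^bsub>T\<^esub> x) \<longrightarrow> x \<in> h)"
    (is "_ \<longleftrightarrow> ?chain h \<and> ?max")
proof -
  have chain: "pred_on.chain UNIV (le T) c \<longleftrightarrow> ?chain c" for c
    using temporal_frameD(1)[OF assms] by (auto simp: pred_on.chain_def)
  have Hist: "h \<in> Hist T \<longleftrightarrow> ?chain h \<and> \<not> (\<exists>g. ?chain g \<and> h \<subset> g)"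
    unfolding Hist_def pred_on.maxchain_def chain by simp
  show ?thesis
  proof (intro iffI conjI)
    assume h: "h \<in> Hist T"
    then show "?chain h" using Hist by blast
    show "?max"
    proof (intro allI impI)
      fix x assume x: "\<forall>y\<in>h. x \<unlhd>\<^bsub>T\<^esub> y \<or> y \<unlhd>\<^bsub>T\<^esub> x"
      then have "?chain (insert x h)"
        using \<open>?chain h\<close> temporal_frameD(1)[OF assms] by blast
      then show "x \<in> h" using h Hist by blast
    qed
  next
    assume "?chain h \<and> ?max"
    then show "h \<in> Hist T" unfolding Hist by blast
  qed
qed

lemma history_comparable:
  assumes "is_temporal_frame T" "h \<in> Hist T" "x \<in> h" "y \<in> h"
  shows "x \<unlhd>\<^bsub>T\<^esub> y \<or> y \<unlhd>\<^bsub>T\<^esub> x"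
  using assms Hist_iff by blast

lemma history_down_closed:
  assumes T: "is_temporal_frame T" and h: "h \<in> Hist T" "y \<in> h" and xy: "x \<unlhd>\<^bsub>T\<^esub> y"
  shows "x \<in> h"
proof -
  have "x \<unlhd>\<^bsub>T\<^esub> z \<or> z \<unlhd>\<^bsub>T\<^esub> x" if "z \<in> h" for z
    using history_comparable[OF T h(1) h(2) that] temporal_frameD(2,4)[OF T] xy by blast
  then show ?thesis using Hist_iff[OF T] h by blast
qed

lemma H_antimono:
  assumes "is_temporal_frame T" "m \<unlhd>\<^bsub>T\<^esub> m'"
  shows "H T m' \<subseteq> H T m"
  using history_down_closed[OF assms(1)] assms(2) unfolding H_def by blast

text \<open>A maximal chain among the moments comparable with \<open>m\<close> contains \<open>m\<close>, and no moment outside this set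
  can enlarge it.\<close>

lemma H_nonempty:
  assumes T: "is_temporal_frame T"
  shows "H T m \<noteq> {}"
proof -
  define A where "A = {x. x \<unlhd>\<^bsub>T\<^esub> m \<or> m \<unlhd>\<^bsub>T\<^esub> x}"
  obtain C where C: "pred_on.maxchain A (le T) C"
    using pred_on.Hausdorff by blast
  have chain: "pred_on.chain A (le T) D \<longleftrightarrow>
      D \<subseteq> A \<and> (\<forall>x\<in>D. \<forall>y\<in>D. x \<unlhd>\<^bsub>T\<^esub> y \<or> y \<unlhd>\<^bsub>T\<^esub> x)" for D
    using temporal_frameD(1)[OF T] by (auto simp: pred_on.chain_def)
  have CA: "C \<subseteq> A" and lin: "\<forall>x\<in>C. \<forall>y\<in>C. x \<unlhd>\<^bsub>T\<^esub> y \<or> y \<unlhd>\<^bsub>T\<^esub> x"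
    and max: "\<And>D. pred_on.chain A (le T) D \<Longrightarrow> \<not> C \<subset> D"
    using C unfolding pred_on.maxchain_def chain by blast+
  have enlarge: "x \<in> C" if "x \<in> A" "\<forall>y\<in>C. x \<unlhd>\<^bsub>T\<^esub> y \<or> y \<unlhd>\<^bsub>T\<^esub> x" for x
  proof -
    have "pred_on.chain A (le T) (insert x C)"
      unfolding chain using CA lin that temporal_frameD(1)[OF T] by blast
    then show ?thesis using max by blast
  qed
  have "m \<in> C"
    using CA temporal_frameD(1)[OF T] by (intro enlarge) (auto simp: A_def)
  moreover have "x \<in> C" if "\<forall>y\<in>C. x \<unlhd>\<^bsub>T\<^esub> y \<or> y \<unlhd>\<^bsub>T\<^esub> x" for x
    using that \<open>m \<in> C\<close> by (intro enlarge) (auto simp: A_def)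
  ultimately show ?thesis
    using lin Hist_iff[OF T] unfolding H_def by blast
qed

lemma H_maximal_moment:
  assumes T: "is_temporal_frame T" and h: "h \<in> H T m" and g: "g \<in> H T m"
    and end_of_h: "\<And>x. x \<in> h \<Longrightarrow> \<not> m \<lhd>\<^bsub>T\<^esub> x"
  shows "g = h"
proof -
  have below: "x \<unlhd>\<^bsub>T\<^esub> m" if "x \<in> h" for x
    using history_comparable[OF T _ that] h end_of_h[OF that] temporal_frameD(1)[OF T]
    unfolding H_def lt_def by blast
  have "h \<subseteq> g"
    using below history_down_closed[OF T] g unfolding H_def by blast
  moreover have "x \<in> h" if "x \<in> g" for x
  proof -
    have "x \<unlhd>\<^bsub>T\<^esub> y \<or> y \<unlhd>\<^bsub>T\<^esub> x" if "y \<in> h" for y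
      using history_comparable[OF T, of g] g \<open>x \<in> g\<close> \<open>h \<subseteq> g\<close> that unfolding H_def by blast
    then show ?thesis using Hist_iff[OF T] h unfolding H_def by blast
  qed
  ultimately show ?thesis by blast
qed

lemma undivided_through:
  assumes "is_temporal_frame T" "m \<lhd>\<^bsub>T\<^esub> m'" "h \<in> H T m'" "g \<in> H T m'"
  shows "undivided T m h g"
  using H_antimono[of T m m'] assms unfolding undivided_def lt_def by blast

lemma undivided_sym: "undivided T m h g \<Longrightarrow> undivided T m g h"
  unfolding undivided_def by blast

text \<open>Two moments after \<open>m\<close> that witness undividedness of \<open>h, g\<close> and of \<open>g, k\<close> lie both on \<open>g\<close>;
  the earlier one lies on all three histories.\<close>

lemma undivided_trans:
  assumes T: "is_temporal_frame T" and hg: "undivided T m h g" and gk: "undivided T m g k"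
  shows "undivided T m h k"
proof -
  obtain a where a: "m \<lhd>\<^bsub>T\<^esub> a" "h \<in> H T a" "g \<in> H T a"
    using hg unfolding undivided_def by blast
  obtain b where b: "m \<lhd>\<^bsub>T\<^esub> b" "g \<in> H T b" "k \<in> H T b"
    using gk unfolding undivided_def by blast
  have "a \<unlhd>\<^bsub>T\<^esub> b \<or> b \<unlhd>\<^bsub>T\<^esub> a"
    using history_comparable[OF T, of g] a b unfolding H_def by blast
  then show ?thesis
    using undivided_through[OF T a(1)] undivided_through[OF T b(1)] a b H_antimono[OF T] by blast
qed

lemma undivided_refl:
  assumes T: "is_temporal_frame T" and m1: "m \<lhd>\<^bsub>T\<^esub> m1" and h: "h \<in> H T m"
  shows "undivided T m h h"
proof -
  have "\<exists>x\<in>h. m \<lhd>\<^bsub>T\<^esub> x"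
  proof (rule ccontr)
    assume no: "\<not> ?thesis"
    obtain g where g: "g \<in> H T m1" using H_nonempty[OF T] by blast
    then have "g \<in> H T m" using H_antimono[OF T] m1 unfolding lt_def by blast
    then have "g = h" using H_maximal_moment[OF T h] no by blast
    then show False using g m1 no unfolding H_def by blast
  qed
  then show ?thesis using h unfolding undivided_def H_def by blast
qed

text \<open>A model and the frame it is based on are records of different types; the temporal notions
  see only their common order.\<close>

lemma frame_notions_cong:
  assumes "le T = le T'"
  shows "lt T = lt T'" "H T = H T'" "MH T = MH T'" "undivided T = undivided T'"
    and "Next T = Next T'" "is_temporal_frame T = is_temporal_frame T'"
    and "mixed_successor T = mixed_successor T'"
proof -
  show lt: "lt T = lt T'" by (intro ext) (simp add: lt_def assms)
  show H: "H T = H T'" by (intro ext) (simp add: H_def Hist_def assms)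
  show "MH T = MH T'" by (simp add: MH_def H)
  show und: "undivided T = undivided T'" by (intro ext) (simp add: undivided_def lt H)
  show nxt: "Next T = Next T'" by (intro ext) (simp add: Next_def lt assms)
  show "is_temporal_frame T = is_temporal_frame T'" by (simp add: is_temporal_frame_def assms)
  show "mixed_successor T = mixed_successor T'"
    by (simp add: mixed_successor_def lt H und nxt assms)
qed

section \<open>Soundness of the axioms\<close>

lemma
  assumes "is_jstit_model Ag M"
  shows model_temporal_frame: "is_temporal_frame M"
    and choice_partition: "j \<in> Ag \<Longrightarrow> partition_on (H M m) (choice M m j)"
    and choice_independent: "(\<And>j. j \<in> Ag \<Longrightarrow> f j \<in> choice M m j) \<Longrightarrow> (\<Inter>j\<in>Ag. f j) \<noteq> {}"
    and R_refl: "R M m m"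
    and R_trans: "R M a b \<Longrightarrow> R M b c \<Longrightarrow> R M a c"
    and Re_trans: "Re M a b \<Longrightarrow> Re M b c \<Longrightarrow> Re M a c"
    and le_imp_R: "m \<unlhd>\<^bsub>M\<^esub> m' \<Longrightarrow> R M m m'"
    and R_imp_Re: "R M m m' \<Longrightarrow> Re M m m'"
  using assms unfolding is_jstit_model_def is_jstit_frame_def is_stit_frame_def
  by (simp_all add: le_fun_def reflp_def) (metis transpD)+

lemma
  assumes "is_jstit_model Ag M"
  shows evid_mono: "Re M m m' \<Longrightarrow> A \<in> evid M m t \<Longrightarrow> A \<in> evid M m' t"
    and evid_app: "(A \<^bold>\<longrightarrow> B) \<in> evid M m s \<Longrightarrow> A \<in> evid M m t \<Longrightarrow> B \<in> evid M m (s \<otimes> t)"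
    and evid_sum: "A \<in> evid M m s \<or> A \<in> evid M m t \<Longrightarrow> A \<in> evid M m (s \<oplus> t)"
    and evid_check: "A \<in> evid M m t \<Longrightarrow> (t \<^bold>: A) \<in> evid M m (\<^bold>! t)"
  using assms unfolding is_jstit_model_def by (elim conjE, metis subsetD UnI1 UnI2)+

lemma
  assumes "is_jstit_model Ag M"
  shows act_mono: "m' \<lhd>\<^bsub>M\<^esub> m \<Longrightarrow> h \<in> H M m \<Longrightarrow> act M m' h \<subseteq> act M m h"
    and act_all_before: "t \<in> act_all M m \<Longrightarrow> \<exists>m'. m' \<lhd>\<^bsub>M\<^esub> m \<and> (\<exists>h\<in>H M m. t \<in> act M m' h)"
    and act_all_mono: "Re M m m' \<Longrightarrow> act_all M m \<subseteq> act_all M m'"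
  using assms unfolding is_jstit_model_def by (simp_all add: subset_iff)

lemma act_undivided:
  assumes "is_jstit_model Ag M" "undivided M m h h'"
  shows "act M m h = act M m h'"
proof -
  have "h \<in> H M m" "h' \<in> H M m" using assms(2) unfolding undivided_def by blast+
  then show ?thesis using assms unfolding is_jstit_model_def by blast
qed

lemma cell_eqI:
  assumes "partition_on (H F m) (choice F m j)" "c \<in> choice F m j" "h \<in> c"
  shows "cell F m j h = c"
  unfolding cell_def using assms partition_onD2[OF assms(1)]
  by (intro the_equality) (auto dest: disjointD)

lemma cell_properties:
  assumes P: "partition_on (H F m) (choice F m j)" and h: "h \<in> H F m"
  shows "cell F m j h \<in> choice F m j" "h \<in> cell F m j h" "cell F m j h \<subseteq> H F m"
    and "h' \<in> cell F m j h \<Longrightarrow> cell F m j h' = cell F m j h"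
proof -
  obtain c where c: "c \<in> choice F m j" "h \<in> c"
    using partition_onD1[OF P] h by blast
  then have eq: "cell F m j h = c" using cell_eqI[OF P] by blast
  show "cell F m j h \<in> choice F m j" "h \<in> cell F m j h" "cell F m j h \<subseteq> H F m"
    using c eq partition_onD1[OF P] by blast+
  show "h' \<in> cell F m j h \<Longrightarrow> cell F m j h' = cell F m j h"
    using cell_eqI[OF P c(1)] eq by blast
qed

lemma bool_eval_sat: "bool_eval (sat M m h) A = sat M m h A"
  by (induction A) auto

lemma sat_Conj: "sat M m h (Conj As) \<longleftrightarrow> (\<forall>A\<in>set As. sat M m h A)"
  by (induction As rule: Conj.induct) auto

lemma sat_Disj: "sat M m h (Disj As) \<longleftrightarrow> (\<exists>A\<in>set As. sat M m h A)"
  by (induction As rule: Disj.induct) auto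

lemma agents_Conj: "agents (Conj As) = (\<Union>A\<in>set As. agents A)"
  by (induction As rule: Conj.induct) auto

text \<open>The operators \<open>K\<close>, \<open>\<box>\<close> and \<open>[j]\<close> all quantify over a set \<open>S w\<close> of points seen from the point \<open>w\<close>;
  S4 and S5 hold for them by the usual correspondence with frame properties.\<close>

lemma S4_axiom_sound:
  assumes B: "S4_axiom N B"
    and N: "\<And>w A. sat M (fst w) (snd w) (N A) \<longleftrightarrow> (\<forall>v\<in>S w. sat M (fst v) (snd v) A)"
    and refl: "w \<in> S w" and trans: "\<And>v. v \<in> S w \<Longrightarrow> S v \<subseteq> S w"
  shows "sat M (fst w) (snd w) B"
  using B
proof cases
  case (S4_K A B)
  then show ?thesis by (simp add: N) blast
next
  case (S4_T A)
  then show ?thesis using refl by (simp add: N) blast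
next
  case (S4_4 A)
  then show ?thesis using trans by (simp add: N) blast
qed

lemma S5_axiom_sound:
  assumes B: "S5_axiom N B"
    and N: "\<And>w A. sat M (fst w) (snd w) (N A) \<longleftrightarrow> (\<forall>v\<in>S w. sat M (fst v) (snd v) A)"
    and refl: "w \<in> S w" and eucl: "\<And>v. v \<in> S w \<Longrightarrow> S v = S w"
  shows "sat M (fst w) (snd w) B"
  using B
proof cases
  case S5_S4
  then show ?thesis using eucl by (intro S4_axiom_sound[OF _ N refl]) auto
next
  case (S5_5 A)
  then show ?thesis using eucl by (simp add: N) blast
qed

text \<open>Independence of agents: every agent of the conjunction commits to the cell of a history that
  settles its own formula, the other agents to any cell. A history
  common to all these cells settles all the formulas at once.\<close>

lemma independence_sound:
  assumes M: "is_jstit_model Ag M" and h: "h \<in> H M m"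
    and ne: "jAs \<noteq> []" and dist: "distinct (map fst jAs)" and ag: "fst ` set jAs \<subseteq> Ag"
    and poss: "\<And>j A. (j, A) \<in> set jAs \<Longrightarrow> sat M m h (\<diamond> Stit j A)"
  shows "sat M m h (\<diamond> Conj (map (\<lambda>(j, A). Stit j A) jAs))"
proof -
  note P = choice_partition[OF M]
  have "\<exists>g\<in>H M m. \<forall>A. (j, A) \<in> set jAs \<longrightarrow> sat M m g (Stit j A)" for j
  proof (cases "j \<in> fst ` set jAs")
    case True
    then obtain A where A: "(j, A) \<in> set jAs" by force
    \<comment> \<open>distinctness makes \<open>A\<close> the only formula assigned to \<open>j\<close>\<close>
    then have "A' = A" if "(j, A') \<in> set jAs" for A'
      using dist that by (metis eq_key_imp_eq_value)
    then show ?thesis using poss[OF A] by fastforce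
  next
    case False
    then show ?thesis using h by force
  qed
  then have "\<exists>g. \<forall>j. g j \<in> H M m \<and> (\<forall>A. (j, A) \<in> set jAs \<longrightarrow> sat M m (g j) (Stit j A))"
    unfolding Bex_def by (rule choice[OF allI])
  then obtain g where g: "\<And>j. g j \<in> H M m"
    and sat_g: "\<And>j A. (j, A) \<in> set jAs \<Longrightarrow> sat M m (g j) (Stit j A)"
    by blast
  have "(\<Inter>j\<in>Ag. cell M m j (g j)) \<noteq> {}"
    using choice_independent[OF M] cell_properties(1)[OF P g] by meson
  then obtain k where k: "\<And>j. j \<in> Ag \<Longrightarrow> k \<in> cell M m j (g j)" by blast
  have kH: "k \<in> H M m"
  proof -
    obtain j where "j \<in> Ag" using ne ag by (cases jAs) auto
    then show ?thesis using k cell_properties(3)[OF P g] by blast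
  qed
  have "sat M m k (Stit j A)" if "(j, A) \<in> set jAs" for j A
  proof -
    have "j \<in> Ag" using ag that by force
    then show ?thesis
      using sat_g[OF that] cell_properties(4)[OF P g k] by simp
  qed
  then have "sat M m k (Conj (map (\<lambda>(j, A). Stit j A) jAs))"
    unfolding sat_Conj by auto
  then show ?thesis using kH by auto
qed

lemma axiom_sound:
  assumes M: "is_jstit_model Ag M" and h: "h \<in> H M m" and A: "A \<in> Axioms Ag"
  shows "sat M m h A"
proof -
  note P = choice_partition[OF M]
  have "axiom_instance A" and Ag: "agents A \<subseteq> Ag" using A unfolding Axioms_def Form_def by auto
  then show ?thesis
  proof (induction rule: axiom_instance.induct)
    case (A0 A)
    have "bool_eval (sat M m h) A" using A0(1) unfolding tautology_def by (rule spec)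
    then show ?case by (simp only: bool_eval_sat)
  next
    case (A1_box A)
    have "sat M (fst (m, h)) (snd (m, h)) A"
      by (rule S5_axiom_sound[OF A1_box(1), where S = "\<lambda>w. {fst w} \<times> H M (fst w)"])
        (use h in auto)
    then show ?case by simp
  next
    case (A1_stit j A)
    then have j: "j \<in> Ag" unfolding S5_axiom.simps S4_axiom.simps by auto
    let ?S = "\<lambda>w. {fst w} \<times> cell M (fst w) j (snd w)"
    have "sat M (fst (m, h)) (snd (m, h)) A"
    proof (rule S5_axiom_sound[OF A1_stit(1), where S = ?S])
      show "(m, h) \<in> ?S (m, h)" using cell_properties(2)[OF P[OF j] h] by simp
      show "?S v = ?S (m, h)" if "v \<in> ?S (m, h)" for v
        using that cell_properties(4)[OF P[OF j] h, of "snd v"] by auto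
    qed auto
    then show ?case by simp
  next
    case (A2 A j)
    then have j: "j \<in> Ag" by auto
    then show ?case using cell_properties(3)[OF P[OF j] h] by auto
  next
    case (A3 jAs)
    have ag: "fst ` set jAs \<subseteq> Ag" using A3(3) by (force simp: agents_Conj)
    have "sat M m h (\<diamond> Conj (map (\<lambda>(j, A). Stit j A) jAs))"
      if "sat M m h (Conj (map (\<lambda>(j, A). \<diamond> Stit j A) jAs))"
    proof (rule independence_sound[OF M h A3(1,2) ag])
      fix j A assume "(j, A) \<in> set jAs"
      then show "sat M m h (\<diamond> Stit j A)" using that unfolding sat_Conj by fastforce
    qed
    then show ?case by simp
  next
    case (A4 s A B t)
    show ?case using evid_app[OF M, of A B m s t] by auto
  next
    case (A5 t A)
    show ?case
      using evid_check[OF M, of A m t] evid_mono[OF M, of m _ A t]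
        Re_trans[OF M, of m] R_imp_Re[OF M, of m] by simp blast
  next
    case (A6 s A t)
    show ?case using evid_sum[OF M, of A m s t] by auto
  next
    case (A7 A)
    let ?S = "\<lambda>w. {(m', h'). R M (fst w) m' \<and> h' \<in> H M m'}"
    have "sat M (fst (m, h)) (snd (m, h)) A"
    proof (rule S4_axiom_sound[OF A7(1), where S = ?S])
      show "(m, h) \<in> ?S (m, h)" using h R_refl[OF M] by simp
      show "?S v \<subseteq> ?S (m, h)" if "v \<in> ?S (m, h)" for v
        using that R_trans[OF M, of m "fst v"] by auto
    qed auto
    then show ?case by simp
  next
    case (A8 A)
    show ?case using R_trans[OF M, of m] by simp blast
  next
    case (A9 t)
    show ?case using R_imp_Re[OF M, of m] act_all_mono[OF M, of m] unfolding act_all_def by simp blast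
  qed
qed

section \<open>Soundness of the calculus on mixed successor frames\<close>

lemma CS_sound:
  assumes M: "is_jstit_model Ag M" and N: "CS_normal CS M"
    and CS: "constant_specification Ag CS" and A: "A \<in> CS" and h: "h \<in> H M m"
  shows "sat M m h A"
proof -
  obtain cs B where "A = const_prf cs B" and "cs \<noteq> []" and B: "B \<in> Axioms Ag"
    using CS A unfolding constant_specification_def by blast
  \<comment> \<open>the closure of \<open>CS\<close> under removal of the outermost constant drives the induction\<close>
  have "sat M m h (const_prf cs B)" if "cs \<noteq> [] \<Longrightarrow> const_prf cs B \<in> CS" and "h \<in> H M m" for cs m h
    using that
  proof (induction cs arbitrary: m h)
    case Nil
    then show ?case using axiom_sound[OF M _ B] by (simp add: const_prf_def)
  next
    case (Cons c cs)
    have cCS: "(PConst c \<^bold>: const_prf cs B) \<in> CS" using Cons(2) by (simp add: const_prf_def)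
    have "cs \<noteq> [] \<Longrightarrow> const_prf cs B \<in> CS"
      using CS B Cons(2) unfolding constant_specification_def by blast
    then have "\<forall>m h. h \<in> H M m \<longrightarrow> sat M m h (const_prf cs B)" using Cons.IH by blast
    moreover have "const_prf cs B \<in> evid M m (PConst c)"
      using N cCS unfolding CS_normal_def by blast
    ultimately show ?case by (simp add: const_prf_def)
  qed
  then show ?thesis using \<open>A = _\<close> A h by blast
qed

text \<open>The reason why (R_D) is sound: in a mixed successor frame the set of proofs presented at a moment in
  one history is the set of proofs presented in all histories through some moment that is not
  earlier. That moment is either \<open>m\<close> itself or its immediate successor on \<open>h\<close>.\<close>

lemma act_in_history_realized:
  assumes M: "is_jstit_model Ag M" and mix: "mixed_successor M" and h: "h \<in> H M m"
  shows "\<exists>m'. m \<unlhd>\<^bsub>M\<^esub> m' \<and> act_all M m' = act M m h"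
proof (cases "\<forall>g\<in>H M m. act M m g = act M m h")
  case True
  then have "act_all M m = act M m h" unfolding act_all_def using h by blast
  then show ?thesis using temporal_frameD(1)[OF model_temporal_frame[OF M]] by blast
next
  case False
  note T = model_temporal_frame[OF M]
  have "\<not> (\<forall>h\<in>H M m. \<forall>g\<in>H M m. undivided M m h g)"
    using False h act_undivided[OF M] by blast
  moreover obtain m1 where m1: "m1 \<in> h" "m \<lhd>\<^bsub>M\<^esub> m1"
    using False H_maximal_moment[OF T h] by blast
  ultimately obtain m2 where m2: "m2 \<unlhd>\<^bsub>M\<^esub> m1" "Next M m m2"
    using mix unfolding mixed_successor_def by blast
  have lt: "m \<lhd>\<^bsub>M\<^esub> m2" and before: "\<And>x. x \<lhd>\<^bsub>M\<^esub> m2 \<Longrightarrow> x \<unlhd>\<^bsub>M\<^esub> m"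
    using m2(2) unfolding Next_def by blast+
  have hm2: "h \<in> H M m2"
    using history_down_closed[OF T _ m1(1) m2(1)] h unfolding H_def by blast
  have same: "act M m g = act M m h" if "g \<in> H M m2" for g
    using act_undivided[OF M] undivided_through[OF T lt that hm2] by blast
  have "act M m h \<subseteq> act_all M m2"
    using same act_mono[OF M lt] unfolding act_all_def by blast
  moreover have "t \<in> act M m h" if t: "t \<in> act_all M m2" for t
  proof -
    obtain x g where x: "x \<lhd>\<^bsub>M\<^esub> m2" "g \<in> H M m2" "t \<in> act M x g"
      using act_all_before[OF M t] by blast
    have "g \<in> H M m" using x(2) H_antimono[OF T] lt unfolding lt_def by blast
    then have "t \<in> act M m g"
      using x(3) before[OF x(1)] act_mono[OF M, of x m g] unfolding lt_def by blast
    then show ?thesis using same x(2) by blast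
  qed
  ultimately show ?thesis using lt unfolding lt_def by blast
qed

lemma RD_sound:
  assumes M: "is_jstit_model Ag M" and mix: "mixed_successor M" and h: "h \<in> H M m"
    and prem: "\<And>m h. h \<in> H M m \<Longrightarrow>
      sat M m h (\<^bold>K A \<^bold>\<longrightarrow> Disj (map (\<lambda>t. \<^bold>\<not> \<box> \<^bold>E t) ts @ map (\<lambda>s. \<box> \<^bold>E s) ss))"
  shows "sat M m h (\<^bold>K A \<^bold>\<longrightarrow> Disj (map (\<lambda>t. \<^bold>\<not> \<^bold>E t) ts @ map (\<lambda>s. \<^bold>E s) ss))"
proof -
  obtain m' where m': "m \<unlhd>\<^bsub>M\<^esub> m'" "act_all M m' = act M m h"
    using act_in_history_realized[OF M mix h] by blast
  obtain g where g: "g \<in> H M m'" using H_nonempty[OF model_temporal_frame[OF M]] by blast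
  have box: "sat M m' g (\<box> \<^bold>E t) \<longleftrightarrow> sat M m h (\<^bold>E t)" for t
    using m'(2) unfolding act_all_def by auto
  have "sat M m' g (\<^bold>K A)" if "sat M m h (\<^bold>K A)"
    using that R_trans[OF M] le_imp_R[OF M m'(1)] by auto
  moreover have "sat M m' g (Disj (map (\<lambda>t. \<^bold>\<not> \<box> \<^bold>E t) ts @ map (\<lambda>s. \<box> \<^bold>E s) ss)) \<longleftrightarrow>
      sat M m h (Disj (map (\<lambda>t. \<^bold>\<not> \<^bold>E t) ts @ map (\<lambda>s. \<^bold>E s) ss))"
    using box by (simp add: sat_Disj bex_Un)
  ultimately show ?thesis using prem[OF g] by (simp del: sat.simps(5,7))
qed

theorem soundness:
  assumes M: "is_jstit_model Ag M" and mix: "mixed_successor M"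
    and N: "CS_normal CS M" and CS: "constant_specification Ag CS"
    and A: "provable Ag CS A"
  shows "valid_in M A"
proof -
  have "sat M m h A" if "h \<in> H M m" for m h
    using A that
  proof (induction arbitrary: m h rule: provable.induct)
    case (Ax A)
    then show ?case using axiom_sound[OF M] by blast
  next
    case (R1 A B)
    then show ?case by auto
  next
    case (R2 A)
    then show ?case by simp
  next
    case (RD A ts ss)
    then show ?case using RD_sound[OF M mix] by blast
  next
    case (RCS A)
    then show ?case using CS_sound[OF M N CS] by blast
  qed
  then show ?thesis unfolding valid_in_def MH_def by auto
qed

section \<open>The countermodel on other frames\<close>

text \<open>One history undivided from \<open>h\<close> is asked for, but then all histories through \<open>m'\<close> are
  undivided from \<open>h\<close> at \<open>m\<close>, since they are pairwise undivided there.\<close>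

definition branch :: "('m, 'z) temporal_frame_scheme \<Rightarrow> 'm \<Rightarrow> 'm set \<Rightarrow> 'm set" where
  "branch T m h = {m'. m \<lhd>\<^bsub>T\<^esub> m' \<and> (\<exists>g\<in>H T m'. undivided T m h g)}"

text \<open>With \<open>R\<close> and \<open>R\<^sub>e\<close> equal to the temporal order, presented proofs have to persist only along
  histories. Trivial choices and total evidence satisfy the remaining
  conditions, and normality for every constant specification.\<close>

definition branch_model :: "'ag set \<Rightarrow> 'm temporal_frame \<Rightarrow> 'm \<Rightarrow> 'm set \<Rightarrow> ('m, 'ag) jstit_model" where
  "branch_model Ag T m h = \<lparr>le = le T, choice = \<lambda>m' j. {H T m'}, R = le T, Re = le T,
     act = \<lambda>m' g. if m' \<in> branch T m h then {PVar 0, PVar 1}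
                   else if m' = m \<and> undivided T m h g then {PVar 0} else {},
     evid = \<lambda>_ _. Form Ag, val = \<lambda>_. {}\<rparr>"

lemma branch_undivided:
  assumes T: "is_temporal_frame T" and "m' \<in> branch T m h" "k \<in> H T m'"
  shows "undivided T m h k"
  using assms undivided_through[OF T] undivided_trans[OF T] unfolding branch_def by blast

lemma branch_up_closed:
  assumes T: "is_temporal_frame T" and b: "m' \<in> branch T m h" and le: "m' \<unlhd>\<^bsub>T\<^esub> m''"
  shows "m'' \<in> branch T m h"
proof -
  have "m \<lhd>\<^bsub>T\<^esub> m''"
    using b le temporal_frameD(2,3)[OF T] unfolding branch_def lt_def by blast
  moreover obtain k where "k \<in> H T m''" using H_nonempty[OF T] by blast
  moreover from this have "undivided T m h k"
    using branch_undivided[OF T b] H_antimono[OF T le] by blast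
  ultimately show ?thesis unfolding branch_def by blast
qed

text \<open>Below every moment of the branch lies some \<open>d\<close> after \<open>m\<close> that is also below \<open>m1\<close>; as \<open>d\<close> is not
  an immediate successor of \<open>m\<close>, something fits between \<open>m\<close> and \<open>d\<close>.\<close>

lemma branch_no_first:
  assumes T: "is_temporal_frame T" and h: "h \<in> H T m1" and m1: "m \<lhd>\<^bsub>T\<^esub> m1"
    and no_next: "\<not> (\<exists>m2. m2 \<unlhd>\<^bsub>T\<^esub> m1 \<and> Next T m m2)"
    and b: "m' \<in> branch T m h"
  shows "\<exists>x. x \<lhd>\<^bsub>T\<^esub> m' \<and> x \<in> branch T m h"
proof -
  have inter: "\<exists>c. m \<lhd>\<^bsub>T\<^esub> c \<and> c \<unlhd>\<^bsub>T\<^esub> a \<and> c \<unlhd>\<^bsub>T\<^esub> b"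
    if "k \<in> Hist T" "a \<in> k" "b \<in> k" "m \<lhd>\<^bsub>T\<^esub> a" "m \<lhd>\<^bsub>T\<^esub> b" for k a b
    using history_comparable[OF T that(1-3)] that(4,5) temporal_frameD(1)[OF T] by blast
  obtain g where g: "g \<in> H T m'" "undivided T m h g" and m': "m \<lhd>\<^bsub>T\<^esub> m'"
    using b unfolding branch_def by blast
  obtain a where a: "m \<lhd>\<^bsub>T\<^esub> a" "h \<in> H T a" "g \<in> H T a"
    using g(2) unfolding undivided_def by blast
  obtain c where c: "m \<lhd>\<^bsub>T\<^esub> c" "c \<unlhd>\<^bsub>T\<^esub> a" "c \<unlhd>\<^bsub>T\<^esub> m1"
    using inter[of h a m1] a h m1 unfolding H_def by blast
  have "c \<in> g" using history_down_closed[OF T _ _ c(2)] a(3) unfolding H_def by blast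
  then obtain d where d: "m \<lhd>\<^bsub>T\<^esub> d" "d \<unlhd>\<^bsub>T\<^esub> c" "d \<unlhd>\<^bsub>T\<^esub> m'"
    using inter[of g c m'] g(1) c(1) m' unfolding H_def by blast
  have "d \<unlhd>\<^bsub>T\<^esub> m1" using d(2) c(3) temporal_frameD(2)[OF T] by blast
  then have "\<not> Next T m d" using no_next by blast
  then obtain x where x: "x \<lhd>\<^bsub>T\<^esub> d" "\<not> x \<unlhd>\<^bsub>T\<^esub> m" using d(1) unfolding Next_def by blast
  have mx: "m \<lhd>\<^bsub>T\<^esub> x"
    using x d(1) temporal_frameD(1,4)[OF T] unfolding lt_def by blast
  have xm': "x \<lhd>\<^bsub>T\<^esub> m'"
    using x(1) d(3) temporal_frameD(2,3)[OF T] unfolding lt_def by blast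
  have "g \<in> H T x" using g(1) H_antimono[OF T] xm' unfolding lt_def by blast
  then have "x \<in> branch T m h" using mx g(2) unfolding branch_def by blast
  then show ?thesis using xm' by blast
qed

lemma branch_model_simps [simp]:
  "le (branch_model Ag T m h) = le T"
  "choice (branch_model Ag T m h) = (\<lambda>m' j. {H T m'})"
  "R (branch_model Ag T m h) = le T"
  "Re (branch_model Ag T m h) = le T"
  "evid (branch_model Ag T m h) = (\<lambda>_ _. Form Ag)"
  "val (branch_model Ag T m h) = (\<lambda>_. {})"
  "lt (branch_model Ag T m h) = lt T"
  "H (branch_model Ag T m h) = H T"
  "MH (branch_model Ag T m h) = MH T"
  "undivided (branch_model Ag T m h) = undivided T"
  "is_temporal_frame (branch_model Ag T m h) = is_temporal_frame T"
proof -
  show le: "le (branch_model Ag T m h) = le T" by (simp add: branch_model_def)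
  show "lt (branch_model Ag T m h) = lt T" "H (branch_model Ag T m h) = H T"
    "MH (branch_model Ag T m h) = MH T" "undivided (branch_model Ag T m h) = undivided T"
    "is_temporal_frame (branch_model Ag T m h) = is_temporal_frame T"
    using frame_notions_cong[OF le] by simp_all
qed (simp_all add: branch_model_def)

lemma act_branch_model:
  "act (branch_model Ag T m h) m' g =
     (if m' \<in> branch T m h then {PVar 0, PVar 1}
      else if m' = m \<and> undivided T m h g then {PVar 0} else {})"
  by (simp add: branch_model_def)

text \<open>The history \<open>g\<close>, divided from \<open>h\<close> at \<open>m\<close>, carries no proof at \<open>m\<close>; hence proofs are presented
  in all histories only on the branch.\<close>

lemma act_all_branch_model:
  assumes T: "is_temporal_frame T" and g: "g \<in> H T m" "\<not> undivided T m h g"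
  shows "act_all (branch_model Ag T m h) m' = (if m' \<in> branch T m h then {PVar 0, PVar 1} else {})"
proof (cases "m' \<in> branch T m h")
  case True
  then show ?thesis using H_nonempty[OF T, of m'] by (simp add: act_all_def act_branch_model)
next
  case False
  then have "\<exists>k\<in>H T m'. act (branch_model Ag T m h) m' k = {}"
    using H_nonempty[OF T, of m'] g by (cases "m' = m") (auto simp: act_branch_model)
  then show ?thesis using False unfolding act_all_def by auto
qed

lemma branch_model_is_jstit_model:
  fixes Ag :: "'ag set"
  assumes T: "is_temporal_frame T" and h: "h \<in> H T m1" and m1: "m \<lhd>\<^bsub>T\<^esub> m1"
    and no_next: "\<not> (\<exists>m2. m2 \<unlhd>\<^bsub>T\<^esub> m1 \<and> Next T m m2)"
    and g: "g \<in> H T m" "\<not> undivided T m h g"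
  shows "is_jstit_model Ag (branch_model Ag T m h)" (is "is_jstit_model Ag ?M")
proof -
  note act_all = act_all_branch_model[OF T g]
  have partition: "partition_on (H T a) {H T a}" for a
    using H_nonempty[OF T, of a] by (auto simp: partition_on_def)
  have cell: "cell ?M a j k = H T a" if "k \<in> H T a" for a j k
    using that partition by (intro cell_eqI) simp_all
  have "reflp (le T)" "transp (le T)" using T unfolding is_temporal_frame_def by blast+
  then have frame: "is_jstit_frame Ag ?M"
    using T H_nonempty[OF T] partition cell
    by (auto simp: is_jstit_frame_def is_stit_frame_def)
  have mono: "act ?M a k \<subseteq> act ?M b k" if ab: "a \<lhd>\<^bsub>T\<^esub> b" and k: "k \<in> H T b" for a b k
  proof (cases "a = m \<and> undivided T m h k")
    case True
    then have "b \<in> branch T m h" using ab k unfolding branch_def by blast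
    then show ?thesis by (simp add: act_branch_model)
  next
    case False
    then show ?thesis
      using branch_up_closed[OF T, of a m h b] ab by (auto simp: act_branch_model lt_def)
  qed
  have no_first: "act_all ?M b \<subseteq> (\<Union>a\<in>{a. a \<lhd>\<^bsub>T\<^esub> b}. \<Union>k\<in>H T b. act ?M a k)" for b
  proof (cases "b \<in> branch T m h")
    case True
    then obtain a where "a \<lhd>\<^bsub>T\<^esub> b" "a \<in> branch T m h"
      using branch_no_first[OF T h m1 no_next] by blast
    moreover obtain k where "k \<in> H T b" using H_nonempty[OF T] by blast
    ultimately show ?thesis using True by (force simp: act_all act_branch_model)
  next
    case False
    then show ?thesis by (simp add: act_all)
  qed
  have undiv: "act ?M a k = act ?M a k'" if "undivided T a k k'" for a k k'
  proof (cases "a = m")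
    case True
    then have k: "undivided T m k k'" using that by simp
    have "undivided T m h k \<longleftrightarrow> undivided T m h k'"
      using undivided_trans[OF T _ k] undivided_trans[OF T _ undivided_sym[OF k]] by blast
    then show ?thesis by (simp add: act_branch_model)
  next
    case False
    then show ?thesis by (simp add: act_branch_model)
  qed
  have all_mono: "act_all ?M a \<subseteq> act_all ?M b" if "a \<unlhd>\<^bsub>T\<^esub> b" for a b
    using branch_up_closed[OF T _ that] by (simp add: act_all)
  show ?thesis
    unfolding is_jstit_model_def branch_model_simps
    by (intro conjI allI impI ballI frame no_first)
      ((rule mono undiv all_mono; assumption) | simp add: Form_def)+
qed

text \<open>Take \<open>A = \<box> E x \<longrightarrow> \<box> E y\<close>: by reflexivity of knowledge \<open>K A\<close> implies \<open>A\<close>, and (R_D)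
  then removes the boxes.\<close>

lemma provable_RD_instance:
  "provable Ag CS (\<^bold>K (\<box> \<^bold>E x \<^bold>\<longrightarrow> \<box> \<^bold>E y) \<^bold>\<longrightarrow> Disj [\<^bold>\<not> \<^bold>E x, \<^bold>E y])"
proof -
  let ?A = "\<box> \<^bold>E x \<^bold>\<longrightarrow> \<box> \<^bold>E y"
  have "provable Ag CS (\<^bold>K ?A \<^bold>\<longrightarrow> ?A)"
    by (intro provable.Ax) (simp add: Axioms_def Form_def A7 S4_T)
  moreover have "provable Ag CS ((\<^bold>K ?A \<^bold>\<longrightarrow> ?A) \<^bold>\<longrightarrow> (\<^bold>K ?A \<^bold>\<longrightarrow> Disj [\<^bold>\<not> \<box> \<^bold>E x, \<box> \<^bold>E y]))"
    by (intro provable.Ax) (simp add: Axioms_def Form_def A0 tautology_def)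
  ultimately have "provable Ag CS (\<^bold>K ?A \<^bold>\<longrightarrow> Disj [\<^bold>\<not> \<box> \<^bold>E x, \<box> \<^bold>E y])"
    by (rule provable.R1)
  then show ?thesis using provable.RD[of Ag CS ?A "[x]" "[y]"] by simp
qed

lemma branch_model_refutes:
  fixes Ag :: "'ag set"
  assumes T: "is_temporal_frame T" and h: "undivided T m h h"
    and g: "g \<in> H T m" "\<not> undivided T m h g"
  shows "\<not> sat (branch_model Ag T m h) m h
    (\<^bold>K (\<box> \<^bold>E (PVar 0) \<^bold>\<longrightarrow> \<box> \<^bold>E (PVar 1)) \<^bold>\<longrightarrow> Disj [\<^bold>\<not> \<^bold>E (PVar 0), \<^bold>E (PVar 1)])"
proof -
  let ?M = "branch_model Ag T m h"
  have box: "sat ?M a k (\<box> \<^bold>E t) \<longleftrightarrow> t \<in> act_all ?M a" for a k t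
    by (simp add: act_all_def)
  have "sat ?M a k (\<box> \<^bold>E (PVar 0) \<^bold>\<longrightarrow> \<box> \<^bold>E (PVar 1))" for a k
    unfolding sat.simps(2,3) box act_all_branch_model[OF T g] by simp
  then have "sat ?M m h (\<^bold>K (\<box> \<^bold>E (PVar 0) \<^bold>\<longrightarrow> \<box> \<^bold>E (PVar 1)))" by simp
  moreover have "m \<notin> branch T m h" by (simp add: branch_def lt_def)
  then have "act ?M m h = {PVar 0}" using h by (simp add: act_branch_model)
  ultimately show ?thesis by (simp del: sat.simps(5,7))
qed

lemma CS_formulas:
  assumes "constant_specification Ag CS" "(c \<^bold>: A) \<in> CS"
  shows "A \<in> Form Ag"
proof -
  have "agents (const_prf cs B) = agents B" for cs and B :: "'a fm"
    by (induction cs) (auto simp: const_prf_def)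
  moreover obtain cs B where "c \<^bold>: A = const_prf cs B" "B \<in> Axioms Ag"
    using assms unfolding constant_specification_def by blast
  ultimately have "agents (c \<^bold>: A) \<subseteq> Ag" by (simp add: Axioms_def Form_def)
  then show ?thesis by (simp add: Form_def)
qed

lemma not_mixed_successor_countermodel:
  fixes Ag :: "'ag set" and T :: "'m temporal_frame"
  assumes T: "is_temporal_frame T" and CS: "constant_specification Ag CS"
    and not_mix: "\<not> mixed_successor T"
  shows "\<exists>(M :: ('m, 'ag) jstit_model) A. is_jstit_model Ag M \<and> based_on M T \<and> CS_normal CS M \<and>
    A \<in> Form Ag \<and> provable Ag CS A \<and> \<not> valid_in M A"
proof -
  obtain m m1 h1 h2 where m1: "m \<lhd>\<^bsub>T\<^esub> m1"
    and no_next: "\<not> (\<exists>m2. m2 \<unlhd>\<^bsub>T\<^esub> m1 \<and> Next T m m2)"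
    and h12: "h1 \<in> H T m" "h2 \<in> H T m" "\<not> undivided T m h1 h2"
    using not_mix unfolding mixed_successor_def by blast
  obtain h where h: "h \<in> H T m1" using H_nonempty[OF T] by blast
  then have hm: "h \<in> H T m" using H_antimono[OF T] m1 unfolding lt_def by blast
  \<comment> \<open>undividedness is transitive, so \<open>h\<close> cannot be undivided from both \<open>h1\<close> and \<open>h2\<close>\<close>
  obtain g where g: "g \<in> H T m" "\<not> undivided T m h g"
    using h12 undivided_sym undivided_trans[OF T] by metis
  let ?M = "branch_model Ag T m h"
  let ?A = "\<^bold>K (\<box> \<^bold>E (PVar 0) \<^bold>\<longrightarrow> \<box> \<^bold>E (PVar 1)) \<^bold>\<longrightarrow> Disj [\<^bold>\<not> \<^bold>E (PVar 0), \<^bold>E (PVar 1)] :: 'ag fm"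
  have "is_jstit_model Ag ?M"
    by (rule branch_model_is_jstit_model[OF T h m1 no_next g])
  moreover have "based_on ?M T"
    by (simp add: based_on_def branch_model_def temporal_frame.truncate_def)
  moreover have "CS_normal CS ?M"
    using CS_formulas[OF CS] by (auto simp: CS_normal_def)
  moreover have "?A \<in> Form Ag" by (simp add: Form_def)
  moreover have "provable Ag CS ?A" by (rule provable_RD_instance)
  moreover have "\<not> valid_in ?M ?A"
    using branch_model_refutes[OF T undivided_refl[OF T m1 hm] g] hm
    unfolding valid_in_def MH_def by fastforce
  ultimately show ?thesis by blast
qed

theorem theorem3:
  fixes Ag :: "'ag set" and T :: "'m temporal_frame" and CS :: "'ag fm set"
  assumes "finite Ag"
    and "is_temporal_frame T"
    and "constant_specification Ag CS"
  shows "(\<forall>M :: ('m, 'ag) jstit_model.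
            is_jstit_model Ag M \<and> based_on M T \<and> CS_normal CS M \<longrightarrow>
              (\<forall>A\<in>Form Ag. provable Ag CS A \<longrightarrow> valid_in M A))
         \<longleftrightarrow> T \<in> mixsucc_temporal_frames"
proof
  assume "\<forall>M :: ('m, 'ag) jstit_model.
            is_jstit_model Ag M \<and> based_on M T \<and> CS_normal CS M \<longrightarrow>
              (\<forall>A\<in>Form Ag. provable Ag CS A \<longrightarrow> valid_in M A)"
  then have "mixed_successor T"
    using not_mixed_successor_countermodel[OF assms(2,3)] by metis
  then show "T \<in> mixsucc_temporal_frames"
    using assms(2) by (simp add: mixsucc_temporal_frames_def)
next
  assume "T \<in> mixsucc_temporal_frames"
  then have mix: "mixed_successor T" by (simp add: mixsucc_temporal_frames_def)
  show "\<forall>M :: ('m, 'ag) jstit_model.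
            is_jstit_model Ag M \<and> based_on M T \<and> CS_normal CS M \<longrightarrow>
              (\<forall>A\<in>Form Ag. provable Ag CS A \<longrightarrow> valid_in M A)"
  proof (intro allI impI ballI)
    fix M :: "('m, 'ag) jstit_model" and A
    assume M: "is_jstit_model Ag M \<and> based_on M T \<and> CS_normal CS M"
      and A: "provable Ag CS A"
    have "T = temporal_frame.truncate M" using M by (simp add: based_on_def)
    then have "le M = le T" by (simp add: temporal_frame.truncate_def)
    then have "mixed_successor M" using mix frame_notions_cong(7)[of M T] by simp
    then show "valid_in M A" using soundness[of Ag M CS A] M A assms(3) by simp
  qed
qed

end
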